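(* If there is no $\lambda\in R\cup\{\infty\}$ for which $\Gamma(\lambda)$ is of Type A, then $\frac m2=h_\Phi$. Otherwise, $$\max\{h_\lambda:\ \Gamma(\lambda)\text{ is of Type A}\}=h_\Phi .$$
   Context: Let $m\ge2$ be an integer and let $\Phi\in\mathbb R[x_1,x_2]$ be a nonzero homogeneous polynomial of degree $m$. Factor $\Phi(x_1,x_2)=c_\Phi x_1^{\nu_1}x_2^{\nu_2}\prod_{h=1}^N(x_2-\lambda_hx_1)^{n_h}$ with distinct $\lambda_h\in\mathbb C\setminus\{0\}$ and $\nu_1+\nu_2+\sum_h n_h=m$. Standing assumption: $\nu_1,\nu_2$ and all $n_h$ are $<m$ (equivalently, $\Phi$ is not a constant multiple of the $m$-th power of a real linear form). The height of $\Phi$ is $h_\Phi=\max\{\frac m2,\ \sup_{x\in S^1}\mathrm{ord}\,\Phi(x)\}$, where $S^1$ is the unit circle in $\mathbb R^2$ and $\mathrm{ord}\,\Phi(x)$ is the smallest non-negative integer $j$ such that the $j$-th order total derivative of $\Phi$ at $x$ is non-zero. Let $H\Phi=\partial_{11}\Phi\,\partial_{22}\Phi-(\partial_{12}\Phi)^2$ be the Hessian determinant. Write $H\Phi(x_1,x_2)=x_1^{\alpha_1}\prod_{\lambda\in R}(x_2-\lambda x_1)^{\omega_\lambda}Q(x_1,x_2)$, where $R\subset\mathbb R$ is the finite set of real $\lambda$ (possibly including $0$) with $H\Phi(1,\lambda)=0$, $\omega_\lambda\ge1$, and $Q\neq0$ away from the origin. For $\lambda\in R$ let $L_\lambda=\{x_2=\lambda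 x_1\}$; let $L_\infty=\{x_1=0\}$ if $\alpha_1\ne0$; the index $\lambda=\infty$ is considered only when $\alpha_1\neq 0$. To each such $\lambda$ is attached a small conic sector $\Gamma(\lambda)$ around $L_\lambda\setminus\{(0,0)\}$; $\Gamma(\lambda)$ is of Type A if $\Phi$ vanishes along $L_\lambda\setminus\{(0,0)\}$. In that case, for $\lambda\ne\infty$, $n_\lambda$ is the integer with $\Phi(x_1,x_2)=(x_2-\lambda x_1)^{n_\lambda}P(x_1,x_2)$, where $P$ does not vanish along $L_\lambda\setminus\{(0,0)\}$; for $\lambda=\infty$, $n_\lambda=\nu_1$. Finally $h_\lambda=\max\{m/2,n_\lambda\}$. *)

theory Defs
  imports "HOL-Analysis.Analysis"
begin

text \<open>
  Polynomials in two real variables are identified with the polynomial functions on the Euclidean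
  plane \<^typ>\<open>real \<times> real\<close>; since \<open>\<real>\<close> is infinite, nothing is lost.
\<close>

definition homogeneous_polynomial :: "nat \<Rightarrow> (real \<times> real \<Rightarrow> real) \<Rightarrow> bool" where
  "homogeneous_polynomial m f \<longleftrightarrow>
     (\<exists>a :: nat \<Rightarrow> real. \<forall>x1 x2. f (x1, x2) = (\<Sum>i\<le>m. a i * x1 ^ i * x2 ^ (m - i)))"

text \<open>
  For \<open>j = length vs\<close>, the map \<open>vs \<mapsto> total_derivative f vs x\<close> is the \<open>j\<close>-th order total derivative
  of \<open>f\<close> at \<open>x\<close>, viewed as a \<open>j\<close>-linear form.
\<close>

fun total_derivative ::
  "('a::real_normed_vector \<Rightarrow> real) \<Rightarrow> 'a list \<Rightarrow> 'a \<Rightarrow> real" where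
  "total_derivative f [] x = f x"
| "total_derivative f (v # vs) x = frechet_derivative (total_derivative f vs) (at x) v"

definition ord_at :: "('a::real_normed_vector \<Rightarrow> real) \<Rightarrow> 'a \<Rightarrow> nat" where
  "ord_at f x = (LEAST j. \<exists>vs. length vs = j \<and> total_derivative f vs x \<noteq> 0)"

definition height :: "nat \<Rightarrow> (real \<times> real \<Rightarrow> real) \<Rightarrow> real" where
  "height m f = max (real m / 2) (SUP x\<in>sphere 0 1. real (ord_at f x))"

definition hessian :: "(real \<times> real \<Rightarrow> real) \<Rightarrow> real \<times> real \<Rightarrow> real" where
  "hessian f x =
     total_derivative f [(1,0), (1,0)] x * total_derivative f [(0,1), (0,1)] x
     - (total_derivative f [(1,0), (0,1)] x)\<^sup>2"

datatype slope = Finite_Slope real | Infinite_Slope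

fun line :: "slope \<Rightarrow> (real \<times> real) set" where
  "line (Finite_Slope l) = {(x1, x2). x2 = l * x1}"
| "line Infinite_Slope = {(x1, x2). x1 = 0}"

text \<open>The slopes to which a conic sector is attached; \<open>\<alpha>\<close> is the exponent of \<open>x1\<close> in the Hessian.\<close>

definition sector_slopes :: "real set \<Rightarrow> nat \<Rightarrow> slope set" where
  "sector_slopes R \<alpha> = Finite_Slope ` R \<union> (if \<alpha> \<noteq> 0 then {Infinite_Slope} else {})"

text \<open>
  The type of a conic sector depends only on the behaviour of the polynomial along the line the
  sector surrounds, so it is a property of the slope; the opening of the sector plays no role.
\<close>

definition type_A :: "(real \<times> real \<Rightarrow> real) \<Rightarrow> slope \<Rightarrow> bool" where
  "type_A f s \<longleftrightarrow> (\<forall>x \<in> line s - {(0, 0)}. f x = 0)"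

text \<open>The second argument is the exponent of \<open>x1\<close> in the factorization of \<open>f\<close>.\<close>

fun line_multiplicity :: "(real \<times> real \<Rightarrow> real) \<Rightarrow> nat \<Rightarrow> slope \<Rightarrow> nat" where
  "line_multiplicity f \<nu>1 (Finite_Slope l) =
     (THE n. \<exists>P. real_polynomial_function P \<and>
        (\<forall>x1 x2. f (x1, x2) = (x2 - l * x1) ^ n * P (x1, x2)) \<and>
        (\<forall>x \<in> line (Finite_Slope l) - {(0, 0)}. P x \<noteq> 0))"
| "line_multiplicity f \<nu>1 Infinite_Slope = \<nu>1"

definition line_height :: "nat \<Rightarrow> (real \<times> real \<Rightarrow> real) \<Rightarrow> nat \<Rightarrow> slope \<Rightarrow> real" where
  "line_height m f \<nu>1 s = max (real m / 2) (real (line_multiplicity f \<nu>1 s))"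

end

theory Submission
  imports Defs
begin

text \<open>
  Why the theorem holds. For every real line \<open>L\<close> through the origin, a nonzero homogeneous
  polynomial of two variables has the form \<open>\<ell> ^ k * P\<close>, where \<open>\<ell>\<close> is a linear form that cuts out \<open>L\<close> and the
  polynomial \<open>P\<close> has no zero on \<open>L\<close> except the origin. Differentiating \<open>j \<le> k\<close> times lowers the power
  of \<open>\<ell>\<close> to \<open>k - j\<close>, so on \<open>L\<close> all derivatives of order less than \<open>k\<close> vanish, and those of order \<open>k\<close> are
  an explicit nonzero multiple of \<open>P\<close> (\<open>total_derivative_power_mult\<close>). Hence the order of the
  polynomial at every point of \<open>L\<close> other than the origin is \<open>k\<close> (\<open>ord_at_power_mult\<close>), and the height
  is \<open>max (m/2) K\<close> with \<open>K\<close> the largest exponent \<open>k\<close> that occurs for a real line.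

  The sectors see only the lines on which the Hessian vanishes. This loses nothing: if \<open>k \<ge> 2\<close>, then the
  second derivative at a point of \<open>L\<close> is zero or a multiple of the square of \<open>\<ell>\<close>, so it has rank at
  most one and its determinant vanishes (\<open>hessian_eq_0_if_double_root\<close>). The lines that are missed
  have \<open>k \<le> 1 \<le> m/2\<close> and cannot influence the maximum.

  The factorization of the polynomial is given over \<open>\<complex>\<close>. Collecting the factors that belong to a real line
  yields \<open>\<ell> ^ k * P\<close> with \<open>P\<close> complex-valued. Since \<open>\<ell> ^ k * Im P = 0\<close>, and a power of a nonzero linear
  form can be cancelled (\<open>power_mult_eq_0_cancel\<close>, once more by the derivative formula), \<open>P\<close> is real.
\<close>

section \<open>Derivatives of a polynomial multiple of a power of a linear form\<close>

lemma has_derivative_real_polynomial_function: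
  assumes "real_polynomial_function f"
  shows "(f has_derivative frechet_derivative f (at x)) (at x)"
proof -
  have "f differentiable (at x)"
    using assms
    by (induction) (auto intro!: bounded_linear_imp_differentiable)
  then show ?thesis
    by (simp add: frechet_derivative_works)
qed

lemma frechet_derivative_polynomial_mult:
  assumes "real_polynomial_function f" "real_polynomial_function g"
  shows "frechet_derivative (\<lambda>x. f x * g x) (at x) v =
           f x * frechet_derivative g (at x) v + frechet_derivative f (at x) v * g x"
  using has_derivative_mult[OF assms[THEN has_derivative_real_polynomial_function, of x]]
  by (metis frechet_derivative_at)

lemma real_polynomial_function_frechet_derivative:
  assumes "real_polynomial_function f"
  shows "real_polynomial_function (\<lambda>x. frechet_derivative f (at x) v)"
  using assms
proof induction
  case (linear f)
  then have "frechet_derivative f (at x) = f" for x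
    by (metis bounded_linear_imp_has_derivative frechet_derivative_at)
  then show ?case
    by (simp add: real_polynomial_function.intros(2))
next
  case (const c)
  then show ?case
    by (simp add: real_polynomial_function.intros(2))
next
  case (add f g)
  have "frechet_derivative (\<lambda>x. f x + g x) (at x) v =
          frechet_derivative f (at x) v + frechet_derivative g (at x) v" for x
    using has_derivative_add[OF add.hyps[THEN has_derivative_real_polynomial_function, of x]]
    by (metis frechet_derivative_at)
  then show ?case
    using add by (auto intro: real_polynomial_function.intros(3))
next
  case (mult f g)
  then show ?case
    by (auto simp: frechet_derivative_polynomial_mult
        intro!: real_polynomial_function.intros(3) real_polynomial_function.intros(4))
qed

lemma frechet_derivative_power_linear:
  assumes "bounded_linear l"
  shows "frechet_derivative (\<lambda>x. l x ^ Suc k) (at x) v = (real k + 1) * l v * l x ^ k"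
proof -
  have "(l has_derivative l) (at x)"
    using assms by (rule bounded_linear_imp_has_derivative)
  from has_derivative_power[OF this, of "Suc k"]
  have "((\<lambda>x. l x ^ Suc k) has_derivative (\<lambda>v. (real k + 1) * l v * l x ^ k)) (at x)"
    by (simp add: algebra_simps)
  then show ?thesis
    by (metis frechet_derivative_at)
qed

text \<open>
  Each differentiation of \<open>l ^ Suc k * P'\<close> in a direction \<open>v\<close> takes out one factor \<open>l\<close> and leaves
  \<open>(k + 1) * l v * P' + l * \<partial>\<^sub>v P'\<close>, whose second summand vanishes on the kernel of \<open>l\<close>. The cofactor is
  therefore known on that kernel.
\<close>

lemma total_derivative_power_mult:
  assumes l: "bounded_linear l" and P: "real_polynomial_function P" and "length vs \<le> n"
  shows "\<exists>P'. real_polynomial_function P' \<and>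
           (\<forall>x. total_derivative (\<lambda>x. l x ^ n * P x) vs x = l x ^ (n - length vs) * P' x) \<and>
           (\<forall>x. l x = 0 \<longrightarrow> P' x = fact n / fact (n - length vs) * (\<Prod>v\<leftarrow>vs. l v) * P x)"
  using \<open>length vs \<le> n\<close>
proof (induction vs)
  case Nil
  then show ?case
    using P by auto
next
  case (Cons v vs)
  then obtain P' where P': "real_polynomial_function P'"
    and D: "\<And>x. total_derivative (\<lambda>x. l x ^ n * P x) vs x = l x ^ (n - length vs) * P' x"
    and val: "\<And>x. l x = 0 \<Longrightarrow> P' x = fact n / fact (n - length vs) * (\<Prod>v\<leftarrow>vs. l v) * P x"
    by auto
  define k where "k = n - length (v # vs)"
  have k: "n - length vs = Suc k"
    using Cons.prems by (simp add: k_def)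
  define P'' where "P'' = (\<lambda>x. (real k + 1) * l v * P' x + l x * frechet_derivative P' (at x) v)"
  have "real_polynomial_function P''"
    unfolding P''_def
    by (intro real_polynomial_function.intros P' l
        real_polynomial_function_frechet_derivative)
  moreover have "total_derivative (\<lambda>x. l x ^ n * P x) (v # vs) x = l x ^ k * P'' x" for x
  proof -
    have "total_derivative (\<lambda>x. l x ^ n * P x) vs = (\<lambda>x. l x ^ Suc k * P' x)"
      by (rule ext) (use D k in simp)
    then have "total_derivative (\<lambda>x. l x ^ n * P x) (v # vs) x =
        frechet_derivative (\<lambda>x. l x ^ Suc k * P' x) (at x) v"
      by simp
    also have "\<dots> = l x ^ Suc k * frechet_derivative P' (at x) v + (real k + 1) * l v * l x ^ k * P' x"
      using frechet_derivative_polynomial_mult[OF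
          real_polynomial_function_power[OF real_polynomial_function.intros(1)[OF l]] P', of "Suc k" x v]
      by (simp only: frechet_derivative_power_linear[OF l])
    finally show ?thesis
      by (simp add: P''_def algebra_simps)
  qed
  moreover have "P'' x = fact n / fact k * (\<Prod>v\<leftarrow>v # vs. l v) * P x" if "l x = 0" for x
  proof -
    have "P'' x = ((real k + 1) * (fact n / fact (Suc k))) * (\<Prod>v\<leftarrow>v # vs. l v) * P x"
      using val[OF that] that k by (simp add: P''_def del: fact_Suc)
    also have "(real k + 1) * (fact n / fact (Suc k)) = fact n / fact k"
      by (simp add: divide_simps add.commute)
    finally show ?thesis .
  qed
  ultimately show ?case
    unfolding k_def by blast
qed

text \<open>
  If \<open>v\<close> is transversal to the kernel of \<open>l\<close>, this recovers the values of \<open>P\<close> on the kernel from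
  \<open>l ^ n * P\<close>.
\<close>

lemma nth_total_derivative_power_mult:
  assumes l: "bounded_linear l" and P: "real_polynomial_function P" and "l x = 0"
  shows "total_derivative (\<lambda>x. l x ^ n * P x) (replicate n v) x = fact n * l v ^ n * P x"
  using total_derivative_power_mult[OF l P, of "replicate n v" n] \<open>l x = 0\<close> by auto

lemma ord_at_power_mult:
  assumes l: "bounded_linear l" and P: "real_polynomial_function P"
    and x: "l x = 0" "P x \<noteq> 0" and v: "l v \<noteq> 0"
  shows "ord_at (\<lambda>x. l x ^ n * P x) x = n"
  unfolding ord_at_def
proof (rule Least_equality)
  show "\<exists>vs. length vs = n \<and> total_derivative (\<lambda>x. l x ^ n * P x) vs x \<noteq> 0"
    using nth_total_derivative_power_mult[OF l P x(1), of n v] x v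
    by (intro exI[of _ "replicate n v"]) simp
next
  fix j
  assume "\<exists>vs. length vs = j \<and> total_derivative (\<lambda>x. l x ^ n * P x) vs x \<noteq> 0"
  then obtain vs where vs: "length vs = j" "total_derivative (\<lambda>x. l x ^ n * P x) vs x \<noteq> 0"
    by blast
  show "n \<le> j"
  proof (rule ccontr)
    assume "\<not> n \<le> j"
    then show False
      using total_derivative_power_mult[OF l P, of vs n] vs x by auto
  qed
qed

text \<open>
  Off the kernel of \<open>l\<close> one divides; on the kernel one compares \<open>n\<close>-th derivatives, which avoids a
  density argument.
\<close>

lemma power_mult_eq_0_cancel:
  assumes l: "bounded_linear l" and v: "l v \<noteq> 0" and P: "real_polynomial_function P"
    and 0: "\<And>x. l x ^ n * P x = 0"
  shows "P x = 0"
proof (cases "l x = 0")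
  case True
  have "total_derivative (\<lambda>x. 0) vs = (\<lambda>x. 0)" for vs :: "'a list"
  proof (induction vs)
    case (Cons w vs)
    have "total_derivative (\<lambda>x. 0) (w # vs) = (\<lambda>x. frechet_derivative (\<lambda>x. 0) (at x) w)"
      by (rule ext) (simp only: total_derivative.simps Cons.IH)
    then show ?case
      by simp
  qed auto
  then have "fact n * l v ^ n * P x = 0"
    using nth_total_derivative_power_mult[OF l P True, of n v] by (simp add: 0)
  then show ?thesis
    using v by simp
next
  case False
  then show ?thesis
    using 0[of x] by simp
qed

text \<open>
  On the line \<open>l = 0\<close> the matrix of second derivatives is zero for \<open>n > 2\<close>, and for \<open>n = 2\<close> it is
  \<open>2 * P\<close> times the rank one matrix with entries \<open>l e\<^sub>i * l e\<^sub>j\<close>.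
\<close>

lemma hessian_eq_0_if_double_root:
  assumes l: "bounded_linear l" and P: "real_polynomial_function P"
    and x: "l x = 0" and n: "2 \<le> n"
  shows "hessian (\<lambda>x. l x ^ n * P x) x = 0"
proof -
  define q where "q = 0 ^ (n - 2) * (fact n / fact (n - 2)) * P x"
  have "total_derivative (\<lambda>x. l x ^ n * P x) [a, b] x = q * l a * l b" for a b
  proof -
    have "length [a, b] \<le> n"
      using n by simp
    from total_derivative_power_mult[OF l P this] obtain P' where
      "\<And>x. total_derivative (\<lambda>x. l x ^ n * P x) [a, b] x = l x ^ (n - length [a, b]) * P' x"
      "\<And>x. l x = 0 \<Longrightarrow> P' x = fact n / fact (n - length [a, b]) * (\<Prod>v\<leftarrow>[a, b]. l v) * P x"
      by blast
    from this(1)[of x] this(2)[OF x] show ?thesis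
      using x by (simp add: q_def numeral_2_eq_2 del: total_derivative.simps)
  qed
  then show ?thesis
    by (simp add: hessian_def power2_eq_square)
qed

section \<open>Lines through the origin\<close>

fun slope_form :: "slope \<Rightarrow> real \<times> real \<Rightarrow> real" where
  "slope_form (Finite_Slope l) x = snd x - l * fst x"
| "slope_form Infinite_Slope x = fst x"

fun slope_vector :: "slope \<Rightarrow> real \<times> real" where
  "slope_vector (Finite_Slope l) = (1, l)"
| "slope_vector Infinite_Slope = (0, 1)"

lemma bounded_linear_slope_form: "bounded_linear (slope_form s)"
proof (cases s)
  case (Finite_Slope l)
  have "bounded_linear (\<lambda>x :: real \<times> real. snd x - l * fst x)"
    by (intro bounded_linear_sub bounded_linear_snd bounded_linear_const_mult bounded_linear_fst)
  also have "(\<lambda>x. snd x - l * fst x) = slope_form s"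
    using Finite_Slope by auto
  finally show ?thesis .
next
  case Infinite_Slope
  have "slope_form s = fst"
    using Infinite_Slope by auto
  then show ?thesis
    by (simp add: bounded_linear_fst)
qed

lemma slope_form_nonzero: "\<exists>v. slope_form s v \<noteq> 0"
proof (cases s)
  case (Finite_Slope l)
  then have "slope_form s (0, 1) \<noteq> 0"
    by simp
  then show ?thesis ..
next
  case Infinite_Slope
  then have "slope_form s (1, 0) \<noteq> 0"
    by simp
  then show ?thesis ..
qed

lemma mem_line_iff: "x \<in> line s \<longleftrightarrow> slope_form s x = 0"
  by (cases s; cases x) auto

lemma slope_vector_in_line: "slope_vector s \<in> line s - {(0, 0)}"
  by (cases s) auto

lemma ex_line_through: "\<exists>s. x \<in> line s"
proof (cases x)
  case (Pair a b)
  show ?thesis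
  proof (cases "a = 0")
    case True
    then show ?thesis
      using Pair by (intro exI[of _ Infinite_Slope]) simp
  next
    case False
    then show ?thesis
      using Pair by (intro exI[of _ "Finite_Slope (b / a)"]) simp
  qed
qed

lemma line_meets_sphere: "\<exists>x \<in> line s \<inter> sphere 0 1. x \<noteq> (0, 0)"
proof -
  define u where "u = slope_vector s"
  have u: "u \<noteq> 0" "slope_form s u = 0"
    using slope_vector_in_line[of s] by (auto simp: u_def mem_line_iff zero_prod_def)
  have lin: "linear (slope_form s)"
    by (rule bounded_linear.linear[OF bounded_linear_slope_form])
  show ?thesis
  proof (intro bexI[of _ "sgn u"] IntI)
    show "sgn u \<noteq> (0, 0)"
      using u(1) by (simp add: sgn_zero_iff flip: zero_prod_def)
    show "sgn u \<in> line s"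
      using u(2) by (simp add: mem_line_iff sgn_div_norm linear_scale[OF lin])
    show "sgn u \<in> sphere 0 1"
      using u(1) by (simp add: norm_sgn)
  qed
qed

section \<open>Multiplicity of a polynomial along a line\<close>

definition factors_along :: "(real \<times> real \<Rightarrow> real) \<Rightarrow> slope \<Rightarrow> nat \<Rightarrow> bool" where
  "factors_along f s k \<longleftrightarrow>
     (\<exists>P. real_polynomial_function P \<and> (\<forall>x. f x = slope_form s x ^ k * P x) \<and>
          (\<forall>x \<in> line s - {(0, 0)}. P x \<noteq> 0))"

lemma factors_alongE:
  assumes "factors_along f s k"
  obtains P where "real_polynomial_function P" "f = (\<lambda>x. slope_form s x ^ k * P x)"
    "\<And>x. x \<in> line s - {(0, 0)} \<Longrightarrow> P x \<noteq> 0"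
  using assms unfolding factors_along_def by (metis ext)

lemma ord_at_factors_along:
  assumes "factors_along f s k" "x \<in> line s - {(0, 0)}"
  shows "ord_at f x = k"
proof -
  obtain v where v: "slope_form s v \<noteq> 0"
    using slope_form_nonzero by blast
  obtain P where P: "real_polynomial_function P" "f = (\<lambda>x. slope_form s x ^ k * P x)" "P x \<noteq> 0"
    using factors_alongE[OF assms(1)] assms(2) by metis
  have "slope_form s x = 0"
    using assms(2) by (simp add: mem_line_iff)
  then show ?thesis
    unfolding P(2) using ord_at_power_mult[OF bounded_linear_slope_form P(1)] P(3) v by blast
qed

lemma type_A_iff_factors_along:
  assumes "factors_along f s k"
  shows "type_A f s \<longleftrightarrow> k \<noteq> 0"
proof -
  obtain P where P: "f = (\<lambda>x. slope_form s x ^ k * P x)"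
    "\<And>x. x \<in> line s - {(0, 0)} \<Longrightarrow> P x \<noteq> 0"
    using factors_alongE[OF assms] by metis
  then have "f x = 0 \<longleftrightarrow> k \<noteq> 0" if "x \<in> line s - {(0, 0)}" for x
    using that by (simp add: mem_line_iff power_0_left)
  then show ?thesis
    unfolding type_A_def using slope_vector_in_line[of s] by blast
qed

text \<open>The exponent is determined because it is the order at the points of the line.\<close>

lemma line_multiplicity_eq:
  assumes "factors_along f s k" "s = Infinite_Slope \<Longrightarrow> k = \<nu>1"
  shows "line_multiplicity f \<nu>1 s = k"
proof (cases s)
  case (Finite_Slope l)
  have "line_multiplicity f \<nu>1 s = (THE n. factors_along f s n)"
    by (simp add: Finite_Slope factors_along_def split_paired_all)
  also have "\<dots> = k"
    using assms(1) ord_at_factors_along[OF _ slope_vector_in_line] by (metis the_equality)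
  finally show ?thesis .
qed (use assms in simp)

lemma hessian_factors_along:
  assumes "factors_along f s k" "2 \<le> k" "x \<in> line s"
  shows "hessian f x = 0"
  using assms
  by (elim factors_alongE)
     (auto simp: mem_line_iff intro!: hessian_eq_0_if_double_root bounded_linear_slope_form)

section \<open>From the complex factorization to real cofactors\<close>

definition complex_polynomial_function :: "('a::real_normed_vector \<Rightarrow> complex) \<Rightarrow> bool" where
  "complex_polynomial_function p \<longleftrightarrow>
     real_polynomial_function (\<lambda>x. Re (p x)) \<and> real_polynomial_function (\<lambda>x. Im (p x))"

lemma complex_polynomial_function_const: "complex_polynomial_function (\<lambda>x. c)"
  by (auto simp: complex_polynomial_function_def)

lemma complex_polynomial_function_of_real:
  assumes "real_polynomial_function p"
  shows "complex_polynomial_function (\<lambda>x. complex_of_real (p x))"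
  using assms by (auto simp: complex_polynomial_function_def)

lemma complex_polynomial_function_diff:
  assumes "complex_polynomial_function p" "complex_polynomial_function q"
  shows "complex_polynomial_function (\<lambda>x. p x - q x)"
  using assms by (auto simp: complex_polynomial_function_def)

lemma complex_polynomial_function_mult:
  assumes "complex_polynomial_function p" "complex_polynomial_function q"
  shows "complex_polynomial_function (\<lambda>x. p x * q x)"
  using assms
  by (auto simp: complex_polynomial_function_def
      intro!: real_polynomial_function_diff real_polynomial_function.intros(3,4))

lemma complex_polynomial_function_power:
  assumes "complex_polynomial_function p"
  shows "complex_polynomial_function (\<lambda>x. p x ^ k)"
  by (induction k)
     (auto intro: complex_polynomial_function_const complex_polynomial_function_mult assms)

lemma complex_polynomial_function_prod:
  assumes "finite I" "\<And>i. i \<in> I \<Longrightarrow> complex_polynomial_function (p i)"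
  shows "complex_polynomial_function (\<lambda>x. \<Prod>i\<in>I. p i x)"
  using assms
  by (induction I)
     (auto intro: complex_polynomial_function_const complex_polynomial_function_mult)

lemmas complex_polynomial_function_intros =
  complex_polynomial_function_const complex_polynomial_function_of_real
  complex_polynomial_function_diff complex_polynomial_function_mult
  complex_polynomial_function_power complex_polynomial_function_prod

text \<open>
  The left-hand side is real and so is the linear form; thus \<open>slope_form s ^ k * Im P\<close> vanishes
  identically, and \<open>P\<close> is its own real part.
\<close>

lemma factors_along_complex:
  assumes P: "complex_polynomial_function P"
    and f: "\<And>x. complex_of_real (f x) = of_real (slope_form s x) ^ k * P x"
    and nz: "\<And>x. x \<in> line s - {(0, 0)} \<Longrightarrow> P x \<noteq> 0"
  shows "factors_along f s k"
proof -
  have split: "f x = slope_form s x ^ k * Re (P x)" "slope_form s x ^ k * Im (P x) = 0" for x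
    using f[of x] by (simp_all add: complex_eq_iff flip: of_real_power)
  obtain v where "slope_form s v \<noteq> 0"
    using slope_form_nonzero by blast
  then have "Im (P x) = 0" for x
    using power_mult_eq_0_cancel[OF bounded_linear_slope_form _ _ split(2)] P
    by (auto simp: complex_polynomial_function_def)
  then have "Re (P x) \<noteq> 0" if "x \<in> line s - {(0, 0)}" for x
    using nz[OF that] by (simp add: complex_eq_iff)
  then show ?thesis
    using P split(1) unfolding factors_along_def complex_polynomial_function_def by blast
qed

text \<open>
  For a real slope \<open>l\<close> the power of the linear form collects all factors with \<open>lam h = l\<close>, and also
  \<open>x2 ^ \<nu>2\<close> if \<open>l = 0\<close>; when there are none, the exponent is \<open>0\<close>. The remaining factors have no zero
  on the line except the origin.
\<close>

lemma factors_along_of_factorization: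
  fixes f :: "real \<times> real \<Rightarrow> real" and N :: nat
  assumes f: "\<And>x1 x2. complex_of_real (f (x1, x2)) =
           c * of_real x1 ^ \<nu>1 * of_real x2 ^ \<nu>2 *
             (\<Prod>h\<in>{1..N}. (of_real x2 - lam h * of_real x1) ^ n h)"
    and c: "c \<noteq> 0"
  shows "\<exists>k. factors_along f s k \<and> (s = Infinite_Slope \<longrightarrow> k = \<nu>1)"
proof (cases s)
  case (Finite_Slope l)
  define A where "A = {1..N} \<inter> {h. lam h = of_real l}"
  define B where "B = {1..N} \<inter> {h. lam h \<noteq> of_real l}"
  define k where "k = (if l = 0 then \<nu>2 else 0) + (\<Sum>h\<in>A. n h)"
  define P where "P = (\<lambda>x. c * of_real (fst x) ^ \<nu>1 * (if l = 0 then 1 else of_real (snd x) ^ \<nu>2) *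
     (\<Prod>h\<in>B. (of_real (snd x) - lam h * of_real (fst x)) ^ n h))"
  have "finite B"
    by (simp add: B_def)
  then have "complex_polynomial_function P"
    unfolding P_def
    by (cases "l = 0")
       (auto intro!: complex_polynomial_function_intros
          real_polynomial_function.intros(1) bounded_linear_fst bounded_linear_snd)
  moreover have "complex_of_real (f x) = of_real (slope_form s x) ^ k * P x" for x
  proof -
    obtain x1 x2 where x: "x = (x1, x2)"
      by (cases x)
    define g where "g h = (complex_of_real x2 - lam h * of_real x1) ^ n h" for h
    have "{1..N} = A \<union> B" "A \<inter> B = {}" "finite A" "finite B"
      by (auto simp: A_def B_def)
    then have "(\<Prod>h\<in>{1..N}. g h) = (\<Prod>h\<in>A. g h) * (\<Prod>h\<in>B. g h)"
      by (simp add: prod.union_disjoint)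
    also have "(\<Prod>h\<in>A. g h) = (of_real x2 - of_real l * of_real x1) ^ (\<Sum>h\<in>A. n h)"
      unfolding power_sum by (intro prod.cong) (auto simp: A_def g_def)
    finally show ?thesis
      using f[of x1 x2] unfolding g_def
      by (cases "l = 0") (simp_all add: x P_def k_def Finite_Slope power_add)
  qed
  moreover have "P x \<noteq> 0" if x: "x \<in> line s - {(0, 0)}" for x
  proof -
    define a where "a = fst x"
    have a: "x = (a, l * a)" "a \<noteq> 0"
      using x by (cases x; auto simp: Finite_Slope a_def)+
    have "of_real (l * a) - lam h * of_real a \<noteq> 0" if "h \<in> B" for h
    proof -
      have "lam h \<noteq> of_real l"
        using that by (simp add: B_def)
      then have "(of_real l - lam h) * of_real a \<noteq> 0"
        using a(2) by simp
      then show ?thesis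
        by (simp only: left_diff_distrib of_real_mult not_False_eq_True)
    qed
    then have "(\<Prod>h\<in>B. (of_real (l * a) - lam h * of_real a) ^ n h) \<noteq> 0"
      unfolding prod_zero_iff[OF \<open>finite B\<close>] by (blast dest: power_not_zero)
    then show ?thesis
      using c a by (simp add: P_def)
  qed
  ultimately have "factors_along f s k"
    by (rule factors_along_complex)
  then show ?thesis
    using Finite_Slope by blast
next
  case Infinite_Slope
  define P where "P = (\<lambda>x. c * of_real (snd x) ^ \<nu>2 *
     (\<Prod>h\<in>{1..N}. (of_real (snd x) - lam h * of_real (fst x)) ^ n h))"
  have "complex_polynomial_function P"
    unfolding P_def
    by (auto intro!: complex_polynomial_function_intros
          real_polynomial_function.intros(1) bounded_linear_fst bounded_linear_snd)
  moreover have "complex_of_real (f x) = of_real (slope_form s x) ^ \<nu>1 * P x" for x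
    using f[of "fst x" "snd x"] by (simp add: P_def Infinite_Slope)
  moreover have "P x \<noteq> 0" if "x \<in> line s - {(0, 0)}" for x
    using that c by (auto simp: P_def Infinite_Slope)
  ultimately have "factors_along f s \<nu>1"
    by (rule factors_along_complex)
  then show ?thesis
    by blast
qed

section \<open>Comparison of the two maxima\<close>

theorem proposition1p4:
  fixes m :: nat and \<Phi> :: "real \<times> real \<Rightarrow> real"
    and c :: complex and \<nu>1 \<nu>2 N :: nat and lam :: "nat \<Rightarrow> complex" and n :: "nat \<Rightarrow> nat"
    and R :: "real set" and \<alpha>1 :: nat and \<omega> :: "real \<Rightarrow> nat" and Q :: "real \<times> real \<Rightarrow> real"
  assumes "m \<ge> 2"
    and "homogeneous_polynomial m \<Phi>" and "\<exists>x. \<Phi> x \<noteq> 0"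
    and "\<And>x1 x2. complex_of_real (\<Phi> (x1, x2)) =
           c * of_real x1 ^ \<nu>1 * of_real x2 ^ \<nu>2 *
             (\<Prod>h\<in>{1..N}. (of_real x2 - lam h * of_real x1) ^ n h)"
    and "inj_on lam {1..N}"
    and "\<And>h. h \<in> {1..N} \<Longrightarrow> lam h \<noteq> 0"
    and "\<And>h. h \<in> {1..N} \<Longrightarrow> n h \<ge> 1"
    and "\<nu>1 + \<nu>2 + (\<Sum>h\<in>{1..N}. n h) = m"
    and "\<nu>1 < m" and "\<nu>2 < m" and "\<And>h. h \<in> {1..N} \<Longrightarrow> n h < m"
    and "R = {l. hessian \<Phi> (1, l) = 0}" and "finite R"
    and "\<And>x1 x2. hessian \<Phi> (x1, x2) =
           x1 ^ \<alpha>1 * (\<Prod>l\<in>R. (x2 - l * x1) ^ \<omega> l) * Q (x1, x2)"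
    and "\<And>l. l \<in> R \<Longrightarrow> \<omega> l \<ge> 1"
    and "real_polynomial_function Q" and "\<And>x. x \<noteq> (0, 0) \<Longrightarrow> Q x \<noteq> 0"
  shows "({s \<in> sector_slopes R \<alpha>1. type_A \<Phi> s} = {} \<longrightarrow> real m / 2 = height m \<Phi>) \<and>
         ({s \<in> sector_slopes R \<alpha>1. type_A \<Phi> s} \<noteq> {} \<longrightarrow>
            Max (line_height m \<Phi> \<nu>1 ` {s \<in> sector_slopes R \<alpha>1. type_A \<Phi> s}) = height m \<Phi>)"
proof -
  note m = assms(1) and fact = assms(4) and R = assms(12) and Hfac = assms(14)
  define S where "S = {s \<in> sector_slopes R \<alpha>1. type_A \<Phi> s}"
  have "c \<noteq> 0"
    using assms(3) fact by auto
  then obtain \<mu> where \<mu>: "\<And>s. factors_along \<Phi> s (\<mu> s)" "\<mu> Infinite_Slope = \<nu>1"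
    using factors_along_of_factorization[OF fact] by metis
  have height_S: "line_height m \<Phi> \<nu>1 s = max (real m / 2) (real (\<mu> s))" for s
    using line_multiplicity_eq[OF \<mu>(1)] \<mu>(2) by (simp add: line_height_def)
  have sector: "s \<in> sector_slopes R \<alpha>1" if "hessian \<Phi> (slope_vector s) = 0" for s
  proof (cases s)
    case (Finite_Slope l)
    then show ?thesis
      using that by (simp add: R sector_slopes_def)
  next
    case Infinite_Slope
    \<comment> \<open>At \<open>(0, 1)\<close> the factorization of the Hessian reads \<open>0 ^ \<alpha>1 * Q (0, 1)\<close>.\<close>
    have "\<alpha>1 \<noteq> 0"
      using that Hfac[of 0 1] assms(17)[of "(0, 1)"] by (intro notI) (simp add: Infinite_Slope)
    then show ?thesis
      by (simp add: Infinite_Slope sector_slopes_def)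
  qed
  have small: "\<mu> s \<le> 1" if "s \<notin> S" for s
  proof (rule ccontr)
    assume "\<not> \<mu> s \<le> 1"
    then have "hessian \<Phi> (slope_vector s) = 0" "type_A \<Phi> s"
      using hessian_factors_along[OF \<mu>(1), of s] slope_vector_in_line[of s]
        type_A_iff_factors_along[OF \<mu>(1), of s] by simp_all
    then show False
      using that sector by (auto simp: S_def)
  qed
  have "finite S"
    using assms(13) by (simp add: S_def sector_slopes_def)
  \<comment> \<open>The orders on the circle are exactly the multiplicities of the lines.\<close>
  have orders: "(\<lambda>x. real (ord_at \<Phi> x)) ` sphere 0 1 = range (\<lambda>s. real (\<mu> s))"
  proof (intro equalityI subsetI)
    fix r
    assume "r \<in> (\<lambda>x. real (ord_at \<Phi> x)) ` sphere 0 1"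
    then obtain x where x: "x \<in> sphere 0 1" "r = real (ord_at \<Phi> x)"
      by blast
    obtain s where "x \<in> line s"
      using ex_line_through by blast
    moreover have "x \<noteq> (0, 0)"
      using x(1) by (auto simp flip: zero_prod_def)
    ultimately show "r \<in> range (\<lambda>s. real (\<mu> s))"
      using ord_at_factors_along[OF \<mu>(1), of x s] x(2) by simp
  next
    fix r
    assume "r \<in> range (\<lambda>s. real (\<mu> s))"
    then obtain s where s: "r = real (\<mu> s)"
      by blast
    obtain x where "x \<in> line s - {(0, 0)}" "x \<in> sphere 0 1"
      using line_meets_sphere[of s] by blast
    then show "r \<in> (\<lambda>x. real (ord_at \<Phi> x)) ` sphere 0 1"
      using ord_at_factors_along[OF \<mu>(1), of x s] s by (intro image_eqI[of _ _ x]) simp_all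
  qed
  have height: "height m \<Phi> = max (real m / 2) (SUP s. real (\<mu> s))"
    by (simp add: height_def orders)
  show ?thesis
    unfolding S_def[symmetric]
  proof (intro conjI impI)
    assume "S = {}"
    then have "(SUP s. real (\<mu> s)) \<le> 1"
      using small by (intro cSUP_least) auto
    then show "real m / 2 = height m \<Phi>"
      using m by (simp add: height)
  next
    assume "S \<noteq> {}"
    define M where "M = Max (line_height m \<Phi> \<nu>1 ` S)"
    have le_M: "max (real m / 2) (real (\<mu> s)) \<le> M" if "s \<in> S" for s
      using that \<open>finite S\<close> unfolding M_def height_S[symmetric] by simp
    then have "real m / 2 \<le> M"
      using \<open>S \<noteq> {}\<close> by fastforce
    have bound: "real (\<mu> s) \<le> M" for s
    proof (cases "s \<in> S")
      case True
      then show ?thesis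
        using le_M by fastforce
    next
      case False
      then show ?thesis
        using small[of s] m \<open>real m / 2 \<le> M\<close> by simp
    qed
    have "M \<in> line_height m \<Phi> \<nu>1 ` S"
      unfolding M_def using \<open>finite S\<close> \<open>S \<noteq> {}\<close> by (intro Max_in) auto
    then obtain s where "M = max (real m / 2) (real (\<mu> s))"
      by (auto simp: height_S)
    moreover have "real (\<mu> s) \<le> (SUP s. real (\<mu> s))"
      using bound by (intro cSUP_upper bdd_aboveI2) auto
    moreover have "(SUP s. real (\<mu> s)) \<le> M"
      using bound by (intro cSUP_least) auto
    ultimately show "Max (line_height m \<Phi> \<nu>1 ` S) = height m \<Phi>"
      using \<open>real m / 2 \<le> M\<close> unfolding M_def[symmetric] height by linarith
  qed
qed

end
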